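(* Let $\epsilon > 0$ and let $\mathcal{A}_1$, $\mathcal{A}_2$, $\mathcal{A}_3$ be three "almost dense" sequences of positive integers. Then there exist constants $0 < c < C$ (independent of $x$) such that for all sufficiently large $x$, the interval $[x, x + x^{34/55 + \epsilon}]$ contains an integer $n = m \cdot a_1 \cdot a_2 \cdot a_3$ for some $a_i \in \mathcal{A}_i$ ($i = 1,2,3$) and a positive integer $m$, with $c x^{1/4} \le a_1, a_2, a_3, m \le C x^{1/4}$.
   Context: An infinite sequence (set) $\mathcal{A}$ of positive integers is called "almost dense" if for every $\epsilon > 0$ there exists a constant $c_{\epsilon,\mathcal{A}} > 0$ such that $\#\{X \le n \le 2X : n \in \mathcal{A}\} \ge c_{\epsilon,\mathcal{A}} X^{1 - \epsilon/4}$ for all sufficiently large $X$. The paper's notation $a_1,a_2,a_3,m \asymp x^{1/4}$ means each lies between two positive constant multiples of $x^{1/4}$, constants independent of $x$. *)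

theory Defs
  imports Complex_Main
begin

definition almost_dense :: "nat set \<Rightarrow> bool" where
  "almost_dense A \<longleftrightarrow>
     infinite A \<and> (\<forall>n\<in>A. 0 < n) \<and>
     (\<forall>\<epsilon>>0. \<exists>c>0. \<forall>\<^sub>F X :: real in at_top.
        real (card {n \<in> A. X \<le> real n \<and> real n \<le> 2 * X}) \<ge> c * X powr (1 - \<epsilon> / 4))"

end

theory Submission
  imports Defs "HOL-Analysis.Analysis" "HOL-Real_Asymp.Real_Asymp"
begin

text \<open>
  Put \<open>P = x\<^bsup>1/4\<^esup> / 3\<close> and let \<open>S\<^sub>i\<close> consist of the elements of \<open>A\<^sub>i\<close> in \<open>[P, 2P]\<close>. For \<open>b = a\<^sub>2 a\<^sub>3\<close> the
  interval \<open>[x, x + H]\<close> contains a multiple of \<open>a\<^sub>1 b\<close> as soon as \<open>z = \<lfloor>(x + H) / b\<rfloor>\<close> satisfies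
  \<open>z mod a\<^sub>1 < l\<close>, provided \<open>l \<le> H / (4P\<^sup>2)\<close>. The values \<open>z\<close> are distinct for distinct \<open>b\<close>, and bounding the
  multiplicative energy by a sum of gcds shows that there are \<open>P\<^bsup>2-o(1)\<^esup>\<close> of them. A variance estimate
  shows that only \<open>P\<^bsup>2-\<delta>\<^esup>\<close> integers \<open>z\<close> of size \<open>P\<^sup>2\<close> fail \<open>z mod a\<^sub>1 < l\<close> for all \<open>a\<^sub>1 \<in> S\<^sub>1\<close>, so some \<open>b\<close>
  works.

  In the variance the events for \<open>a\<close> and \<open>a'\<close> are nearly uncorrelated over a full period \<open>a a'\<close> by the
  Chinese remainder theorem, but this period is as long as the range of \<open>z\<close>. Averaging over \<open>z = c + u + v\<close>
  with \<open>u, v < n\<close> and \<open>n\<close> slightly larger than \<open>P\<^sup>2\<close> makes the incomplete periods contribute only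
  quadratically small relative errors. The argument needs \<open>H\<close> only a little larger than \<open>x\<^bsup>1/2\<^esup>\<close>; here
  \<open>l = k\<^sup>2\<close> with \<open>k = \<lfloor>x\<^bsup>1/20\<^esup>\<rfloor>\<close>, that is, \<open>H\<close> of order \<open>x\<^bsup>3/5\<^esup>\<close>.
\<close>

section \<open>Sums of periodic functions over one and two variables\<close>

lemma sum_lessThan_add:
  fixes f :: "nat \<Rightarrow> 'a::comm_monoid_add"
  shows "(\<Sum>i<m+n. f i) = (\<Sum>i<m. f i) + (\<Sum>i<n. f (m+i))"
  by (induction n) (auto simp: add.assoc)

lemma sum_lessThan_mult:
  fixes f :: "nat \<Rightarrow> 'a::comm_monoid_add"
  shows "(\<Sum>z<m*n. f z) = (\<Sum>i<m. \<Sum>r<n. f (i*n+r))"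
proof (induction m)
  case (Suc m)
  have "(\<Sum>z<Suc m*n. f z) = (\<Sum>z<m*n+n. f z)" by (simp add: add.commute)
  also have "\<dots> = (\<Sum>i<Suc m. \<Sum>r<n. f (i*n+r))"
    by (subst sum_lessThan_add) (simp add: Suc)
  finally show ?case .
qed simp

lemma sum_period_shift:
  fixes G :: "int \<Rightarrow> 'a::cancel_comm_monoid_add"
  assumes per: "\<And>z. G (z + int q) = G z"
  shows "(\<Sum>i<q. G (c + int i)) = (\<Sum>i<q. G (int i))"
proof -
  have step: "(\<Sum>i<q. G (c + 1 + int i)) = (\<Sum>i<q. G (c + int i))" for c
  proof -
    have "G c + (\<Sum>i<q. G (c + 1 + int i)) = (\<Sum>i<Suc q. G (c + int i))"
      by (subst sum.lessThan_Suc_shift) (simp add: add_ac)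
    also have "\<dots> = G c + (\<Sum>i<q. G (c + int i))"
      by (simp add: per add.commute)
    finally show ?thesis by simp
  qed
  show ?thesis
  proof (induction c rule: int_induct[where k = 0])
    case (step1 i) then show ?case by (simp add: step)
  next
    case (step2 i) then show ?case using step[of "i - 1"] by simp
  qed simp
qed

lemma sum_period_mod:
  fixes G :: "int \<Rightarrow> 'a::cancel_comm_monoid_add"
  assumes per: "\<And>z. G (z + int q) = G z" and zero: "(\<Sum>i<q. G (int i)) = 0"
  shows "(\<Sum>i<n. G (c + int i)) = (\<Sum>i<n mod q. G (c + int i))"
proof -
  have "(\<Sum>i<k*q. G (d + int i)) = 0" for k d
  proof -
    have "(\<Sum>i<k*q. G (d + int i)) = (\<Sum>j<k. \<Sum>r<q. G ((d + int (j*q)) + int r))"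
      by (simp add: sum_lessThan_mult add.assoc)
    also have "\<dots> = 0"
      by (simp only: sum_period_shift[of G, OF per] zero sum.neutral_const)
    finally show ?thesis .
  qed
  from this[where d = "c + int (n mod q)" and k = "n div q"]
  have "(\<Sum>i<n mod q + n div q * q. G (c + int i)) = (\<Sum>i<n mod q. G (c + int i))"
    by (subst sum_lessThan_add) (simp add: add.assoc)
  then show ?thesis by simp
qed

text \<open>Whole periods cancel in \<open>v\<close> for each fixed \<open>u\<close>, and then in
  \<open>u\<close> for each fixed \<open>v\<close>, so both ranges shrink to \<open>n mod q\<close>.
  The bound does not grow with \<open>n\<close>; against the \<open>n ^ 2\<close> terms of the
  double sum this is the quadratic saving.\<close>

lemma double_sum_zero_mean:
  fixes G :: "int \<Rightarrow> real"
  assumes per: "\<And>z. G (z + int q) = G z" and zero: "(\<Sum>i<q. G (int i)) = 0" and "q > 0"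
  shows "\<bar>\<Sum>u<n. \<Sum>v<n. G (c + int u + int v)\<bar> \<le> q * (\<Sum>i<q. \<bar>G (int i)\<bar>)"
proof -
  let ?r = "n mod q"
  have r: "?r \<le> q" using assms by (simp add: less_imp_le)
  have "(\<Sum>u<n. \<Sum>v<n. G (c + int u + int v)) = (\<Sum>u<n. \<Sum>v<?r. G ((c + int u) + int v))"
    by (subst sum_period_mod[of G q, OF per zero]) simp
  also have "\<dots> = (\<Sum>v<?r. \<Sum>u<n. G ((c + int v) + int u))"
    by (subst sum.swap) (simp add: algebra_simps)
  also have "\<dots> = (\<Sum>v<?r. \<Sum>u<?r. G ((c + int v) + int u))"
    by (subst sum_period_mod[of G q, OF per zero]) simp
  finally have "\<bar>\<Sum>u<n. \<Sum>v<n. G (c + int u + int v)\<bar> \<le> (\<Sum>v<?r. \<Sum>u<?r. \<bar>G ((c + int v) + int u)\<bar>)"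
    by (auto intro!: order_trans[OF sum_abs] sum_mono)
  also have "\<dots> \<le> (\<Sum>v<?r. \<Sum>u<q. \<bar>G ((c + int v) + int u)\<bar>)"
    using r by (intro sum_mono sum_mono2) auto
  also have "\<dots> = (\<Sum>v<?r. \<Sum>u<q. \<bar>G (int u)\<bar>)"
    by (subst sum_period_shift[of "\<lambda>z. \<bar>G z\<bar>"]) (simp_all add: per)
  also have "\<dots> \<le> q * (\<Sum>i<q. \<bar>G (int i)\<bar>)"
    using r by (simp add: mult_right_mono sum_nonneg)
  finally show ?thesis .
qed

text \<open>Subtracting the mean \<open>S / q\<close> reduces to the case of mean zero. The factor 2
  arises because the subtracted constants add up to at most the sum of \<open>\<bar>F\<bar>\<close>
  over one period.\<close>

lemma double_sum_periodic_le:
  fixes F :: "int \<Rightarrow> real"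
  assumes per: "\<And>z. F (z + int q) = F z" and "q > 0"
  shows "(\<Sum>u<n. \<Sum>v<n. F (c + int u + int v))
    \<le> real n ^ 2 * ((\<Sum>i<q. F (int i)) / q) + 2 * q * (\<Sum>i<q. \<bar>F (int i)\<bar>)"
proof -
  define S where "S = (\<Sum>i<q. F (int i))"
  define G where "G = (\<lambda>z. F z - S / q)"
  have "\<bar>\<Sum>u<n. \<Sum>v<n. G (c + int u + int v)\<bar> \<le> q * (\<Sum>i<q. \<bar>G (int i)\<bar>)"
    using assms by (intro double_sum_zero_mean) (simp_all add: G_def sum_subtractf S_def)
  moreover have "(\<Sum>u<n. \<Sum>v<n. G (c + int u + int v))
    = (\<Sum>u<n. \<Sum>v<n. F (c + int u + int v)) - real n ^ 2 * (S / q)"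
    by (simp add: G_def sum_subtractf power2_eq_square)
  moreover have "(\<Sum>i<q. \<bar>G (int i)\<bar>) \<le> 2 * (\<Sum>i<q. \<bar>F (int i)\<bar>)"
  proof -
    have "(\<Sum>i<q. \<bar>G (int i)\<bar>) \<le> (\<Sum>i<q. \<bar>F (int i)\<bar> + \<bar>S\<bar> / q)"
      unfolding G_def by (intro sum_mono order_trans[OF abs_triangle_ineq4]) simp
    also have "\<dots> = (\<Sum>i<q. \<bar>F (int i)\<bar>) + \<bar>S\<bar>" using \<open>q > 0\<close> by (simp add: sum.distrib)
    finally show ?thesis using sum_abs[of "\<lambda>i. F (int i)" "{..<q}"] unfolding S_def by linarith
  qed
  then have "q * (\<Sum>i<q. \<bar>G (int i)\<bar>) \<le> 2 * q * (\<Sum>i<q. \<bar>F (int i)\<bar>)"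
    using mult_left_mono[of _ _ "real q"] by fastforce
  ultimately show ?thesis unfolding S_def by linarith
qed

section \<open>Residue windows for two moduli\<close>

lemma card_congruent_le:
  fixes g n r :: nat
  shows "g * card {s. s < n \<and> s mod g = r mod g} \<le> n + g"
proof (cases "g = 0")
  case False
  have "inj_on (\<lambda>s. s div g) {s. s < n \<and> s mod g = r mod g}"
    by (rule inj_onI) (metis (mono_tags, lifting) div_mult_mod_eq mem_Collect_eq)
  moreover have "(\<lambda>s. s div g) ` {s. s < n \<and> s mod g = r mod g} \<subseteq> {..n div g}"
    by (auto simp: div_le_mono)
  ultimately have "card {s. s < n \<and> s mod g = r mod g} \<le> card {..n div g}"
    by (intro card_inj_on_le) auto
  then have "g * card {s. s < n \<and> s mod g = r mod g} \<le> g * (n div g + 1)"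
    by (intro mult_left_mono) auto
  also have "\<dots> \<le> n + g" by (simp add: algebra_simps)
  finally show ?thesis .
qed simp

text \<open>After division by \<open>g = gcd a b\<close> the coefficient of \<open>m\<close> is
  invertible modulo \<open>h = b / g\<close>. All solutions thus share one residue modulo
  \<open>h\<close>, which has \<open>g\<close> representatives below \<open>b\<close>.\<close>

lemma card_linear_congruence_le:
  fixes a b r s :: nat
  assumes "b > 0"
  shows "card {m. m < b \<and> (m * a + r) mod b = s} \<le> gcd a b" (is "card ?M \<le> ?g")
proof -
  define g where "g = gcd a b"
  have "g > 0" using assms by (simp add: g_def)
  obtain a' h where a': "a = a' * g" and h: "b = h * g" and cop: "coprime a' h"
    using gcd_coprime_exists[of a b] \<open>g > 0\<close> unfolding g_def by auto
  have cong: "m mod h = m' mod h" if "m \<in> ?M" "m' \<in> ?M" for m m'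
  proof -
    have "int b dvd int (m * a + r) - int (m' * a + r)"
      using that by (metis (mono_tags, lifting) mem_Collect_eq mod_eq_dvd_iff of_nat_mod)
    then have "int g * int h dvd int g * (int a' * (int m - int m'))"
      by (simp add: a' h algebra_simps)
    then have "int h dvd int a' * (int m - int m')"
      using \<open>g > 0\<close> by (subst (asm) dvd_mult_cancel_left) simp
    then have "int h dvd int m - int m'"
      using cop by (simp add: coprime_dvd_mult_right_iff coprime_commute)
    then show ?thesis by (metis mod_eq_dvd_iff of_nat_eq_iff of_nat_mod)
  qed
  have "inj_on (\<lambda>m. m div h) ?M"
  proof (rule inj_onI)
    fix m m' assume m: "m \<in> ?M" "m' \<in> ?M" "m div h = m' div h"
    show "m = m'" using div_mult_mod_eq[of m h] div_mult_mod_eq[of m' h]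
      unfolding cong[OF m(1,2)] m(3) by (rule trans[OF sym])
  qed
  moreover have "(\<lambda>m. m div h) ` ?M \<subseteq> {..<g}"
    using less_mult_imp_div_less[of _ g h] unfolding h by (auto simp: mult.commute)
  ultimately have "card ?M \<le> card {..<g}"
    by (rule card_inj_on_le) simp
  then show ?thesis by (simp add: g_def)
qed

text \<open>Write \<open>z = i * a + r\<close>, so that the first window says \<open>r < l\<close>.
  For fixed \<open>r\<close>, only the residues \<open>s < l\<close> congruent to \<open>r\<close>
  modulo the gcd are reached, each by at most \<open>gcd a b\<close> values of \<open>i\<close>. The
  term \<open>l * l\<close> is what independence predicts; the rest is the error.\<close>

lemma card_two_windows_le:
  fixes a b l :: nat
  assumes "a > 0" "b > 0" "l \<le> a"
  shows "(\<Sum>z<b*a. of_bool (z mod a < l) * of_bool (z mod b < l)) \<le> l * (l + gcd a b)"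
proof -
  let ?g = "gcd a b"
  have count: "(\<Sum>i<b. of_bool ((i*a+r) mod b < l)) \<le> l + ?g" for r
  proof -
    have "(\<Sum>i<b. of_bool ((i*a+r) mod b < l)) = (\<Sum>i<b. \<Sum>s<l. of_bool ((i*a+r) mod b = s) :: nat)"
      by (intro sum.cong refl) (auto simp: of_bool_def sum.delta)
    also have "\<dots> = (\<Sum>s<l. \<Sum>i<b. of_bool ((i*a+r) mod b = s))"
      by (rule sum.swap)
    also have "\<dots> \<le> (\<Sum>s<l. ?g * of_bool (s mod ?g = r mod ?g))"
    proof (rule sum_mono)
      fix s
      have eq: "(\<Sum>i<b. of_bool ((i*a+r) mod b = s)) = card {m. m < b \<and> (m*a+r) mod b = s}"
        by (simp add: of_bool_def sum.If_cases Int_def lessThan_def conj_commute)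
      have "s mod ?g = r mod ?g" if "(m*a+r) mod b = s" for m
      proof -
        have "s mod ?g = (m*a+r) mod ?g"
          using that mod_mod_cancel[of ?g b "m*a+r"] by simp
        also have "\<dots> = r mod ?g"
          by (metis gcd_dvd1 dvd_mult mod_add_left_eq add_0 dvd_imp_mod_0)
        finally show ?thesis .
      qed
      then have "card {m. m < b \<and> (m*a+r) mod b = s} = 0" if "s mod ?g \<noteq> r mod ?g"
        using that by auto
      then show "(\<Sum>i<b. of_bool ((i*a+r) mod b = s)) \<le> ?g * of_bool (s mod ?g = r mod ?g)"
        unfolding eq using card_linear_congruence_le[OF \<open>b > 0\<close>, of a r s] by (cases "s mod ?g = r mod ?g") auto
    qed
    also have "\<dots> = ?g * card {s. s < l \<and> s mod ?g = r mod ?g}"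
      by (simp add: of_bool_def sum.If_cases Int_def lessThan_def conj_commute flip: sum_distrib_left)
    also have "\<dots> \<le> l + ?g" by (rule card_congruent_le)
    finally show ?thesis .
  qed
  have "(\<Sum>z<b*a. of_bool (z mod a < l) * of_bool (z mod b < l))
      = (\<Sum>r<a. \<Sum>i<b. of_bool (r < l) * of_bool ((i*a+r) mod b < l) :: nat)"
    by (subst sum_lessThan_mult, subst sum.swap) (intro sum.cong refl, simp)
  also have "\<dots> = (\<Sum>r<a. of_bool (r < l) * (\<Sum>i<b. of_bool ((i*a+r) mod b < l)))"
    by (simp only: sum_distrib_left)
  also have "\<dots> \<le> (\<Sum>r<a. of_bool (r < l) * (l + ?g))"
    by (intro sum_mono mult_left_mono count) simp
  also have "\<dots> = card ({..<a} \<inter> {..<l}) * (l + ?g)"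
    by (simp add: of_bool_def sum.If_cases lessThan_def flip: sum_distrib_right)
  also have "{..<a} \<inter> {..<l} = {..<l}" using assms by auto
  finally show ?thesis by simp
qed

lemma sum_window:
  fixes a b l :: nat
  assumes "l \<le> a"
  shows "(\<Sum>z<b*a. of_bool (z mod a < l)) = b * l"
proof -
  have eq: "{..<a} \<inter> {..<l} = {..<l}" using assms by auto
  have "(\<Sum>z<b*a. of_bool (z mod a < l)) = (\<Sum>i<b. \<Sum>r<a. of_bool (r < l) :: nat)"
    by (subst sum_lessThan_mult) (intro sum.cong refl, simp)
  also have "(\<Sum>r<a. of_bool (r < l) :: nat) = card ({..<a} \<inter> {..<l})"
    by (simp add: of_bool_def sum.If_cases lessThan_def)
  finally show ?thesis by (simp add: eq)
qed

section \<open>Correlation of centred window indicators\<close>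

text \<open>The constant \<open>l / a\<close> is the density of the window, so the mean over a
  period is 0 when \<open>l \<le> a\<close>. The argument is an integer because the averaging range
  also contains negative points.\<close>

definition window_deviation :: "nat \<Rightarrow> nat \<Rightarrow> int \<Rightarrow> real" where
  "window_deviation l a z = of_bool (z mod int a < int l) - real l / real a"

lemma window_deviation_of_nat:
  "window_deviation l a (int z) = of_bool (z mod a < l) - real l / real a"
  by (simp add: window_deviation_def flip: zmod_int)

text \<open>Expanding the product over the period \<open>b * a\<close>, the main term
  \<open>l ^ 2\<close> of the joint count cancels against the product of the means, leaving
  \<open>l * gcd a b\<close>. The last summand pays for incomplete periods: in the sum of absolute
  values all four terms add up instead of cancelling.\<close>

lemma correlation_le:
  fixes a b l n :: nat and c :: int
  assumes "a > 0" "b > 0" "l \<le> a" "l \<le> b"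
  shows "(\<Sum>u<n. \<Sum>v<n. window_deviation l a (c + int u + int v) * window_deviation l b (c + int u + int v))
    \<le> real n ^ 2 * (l * gcd a b / (a * b)) + 2 * (a * b) * (4 * real l ^ 2 + l * gcd a b)"
proof -
  define F where "F z = window_deviation l a z * window_deviation l b z" for z
  define f where "f a z = (of_bool (z mod a < l) :: real)" for a z :: nat
  have F: "F (int z) = f a z * f b z - l / b * f a z - l / a * f b z + (l / a) * (l / b)" for z
    by (simp add: F_def f_def window_deviation_of_nat algebra_simps)
  have "real (\<Sum>z<b*a. of_bool (z mod a < l)) = b * l" using sum_window[of l a b] assms by simp
  then have fa: "(\<Sum>z<b*a. f a z) = b * l" by (simp add: f_def)
  have "real (\<Sum>z<a*b. of_bool (z mod b < l)) = a * l" using sum_window[of l b a] assms by simp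
  then have fb: "(\<Sum>z<b*a. f b z) = a * l" by (simp add: f_def mult.commute)
  define N where "N = (\<Sum>z<b*a. f a z * f b z)"
  have "real (\<Sum>z<b*a. of_bool (z mod a < l) * of_bool (z mod b < l)) \<le> real (l * (l + gcd a b))"
    using card_two_windows_le[of a b l] assms by (simp only: of_nat_le_iff)
  then have N: "N \<le> real l ^ 2 + l * gcd a b"
    by (simp add: N_def f_def algebra_simps power2_eq_square)
  have "(\<Sum>z<b*a. F (int z)) = N - l / b * (b * l) - l / a * (a * l) + l / a * (b * a * (l / b))"
    by (simp only: F sum.distrib sum_subtractf N_def fa fb sum_distrib_left[symmetric]
        sum_constant card_lessThan of_nat_mult)
  also have "\<dots> = N - real l ^ 2" using assms by (simp add: power2_eq_square)
  finally have S: "(\<Sum>z<b*a. F (int z)) \<le> l * gcd a b" using N by simp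
  have "(\<Sum>z<b*a. \<bar>F (int z)\<bar>) \<le> (\<Sum>z<b*a. f a z * f b z + l / b * f a z + l / a * f b z + (l / a) * (l / b))"
  proof (rule sum_mono)
    fix z
    have "f a z * f b z \<ge> 0" "l / b * f a z \<ge> 0" "l / a * f b z \<ge> 0" "(l / a) * (l / b) \<ge> 0"
      by (simp_all add: f_def)
    moreover have "\<bar>p - q - r + s\<bar> \<le> p + q + r + s" if "p \<ge> 0" "q \<ge> 0" "r \<ge> 0" "s \<ge> 0" for p q r s :: real
      using that by linarith
    ultimately show "\<bar>F (int z)\<bar> \<le> f a z * f b z + l / b * f a z + l / a * f b z + (l / a) * (l / b)"
      unfolding F by blast
  qed
  also have "\<dots> = N + l / b * (b * l) + l / a * (a * l) + l / a * (b * a * (l / b))"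
    by (simp only: sum.distrib N_def fa fb sum_distrib_left[symmetric]
        sum_constant card_lessThan of_nat_mult)
  also have "\<dots> = N + 3 * real l ^ 2" using assms by (simp add: power2_eq_square)
  finally have T: "(\<Sum>z<b*a. \<bar>F (int z)\<bar>) \<le> 4 * real l ^ 2 + l * gcd a b" using N by simp
  have per: "F (z + int (b*a)) = F z" for z
    by (simp add: F_def window_deviation_def mod_add_eq[symmetric] del: mod_add_eq)
  have "(\<Sum>u<n. \<Sum>v<n. F (c + int u + int v))
    \<le> real n ^ 2 * ((\<Sum>i<b*a. F (int i)) / (b*a)) + 2 * real (b*a) * (\<Sum>i<b*a. \<bar>F (int i)\<bar>)"
    using double_sum_periodic_le[where F = F and q = "b*a" and n = n and c = c, OF per] assms by simp
  also have "\<dots> \<le> real n ^ 2 * (l * gcd a b / (b*a)) + 2 * real (b*a) * (4 * real l ^ 2 + l * gcd a b)"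
    using S T assms by (intro add_mono mult_left_mono divide_right_mono) auto
  finally show ?thesis by (simp add: F_def mult.commute)
qed

section \<open>Sums of greatest common divisors\<close>

lemma card_multiples_le:
  fixes g n :: nat
  assumes "g > 0"
  shows "real (card {a\<in>{1..n}. g dvd a}) \<le> n / g"
proof -
  have "inj_on (\<lambda>a. a div g) {a\<in>{1..n}. g dvd a}"
    by (rule inj_onI) (auto simp: dvd_div_eq_iff)
  moreover have "(\<lambda>a. a div g) ` {a\<in>{1..n}. g dvd a} \<subseteq> {1..n div g}"
    using assms by (auto simp: div_le_mono Suc_le_eq div_greater_zero_iff dvd_imp_le)
  ultimately have "card {a\<in>{1..n}. g dvd a} \<le> card {1..n div g}"
    by (rule card_inj_on_le) simp
  then have "real (card {a\<in>{1..n}. g dvd a}) \<le> real (n div g)" by simp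
  also have "\<dots> \<le> n / g" by (rule of_nat_div_le_of_nat)
  finally show ?thesis .
qed

text \<open>The gcd is at most the sum of all common divisors \<open>g\<close>. Exchanging the sums
  gives at most \<open>g * (n / g) ^ 2\<close> for each \<open>g\<close>, hence a harmonic
  sum.\<close>

lemma sum_gcd_le:
  fixes n :: nat
  shows "(\<Sum>a\<in>{1..n}. \<Sum>b\<in>{1..n}. real (gcd a b)) \<le> real n ^ 2 * (1 + ln n)"
proof (cases "n = 0")
  case False
  let ?I = "{1..n}"
  have "(\<Sum>a\<in>?I. \<Sum>b\<in>?I. real (gcd a b))
    \<le> (\<Sum>a\<in>?I. \<Sum>b\<in>?I. \<Sum>g\<in>?I. real g * (of_bool (g dvd a) * of_bool (g dvd b)))"
  proof (intro sum_mono)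
    fix a b assume ab: "a \<in> ?I" "b \<in> ?I"
    then have "gcd a b \<in> ?I"
      by (auto simp: Suc_le_eq intro: order_trans[OF gcd_le1_nat])
    then have "(\<Sum>g\<in>{gcd a b}. real g * (of_bool (g dvd a) * of_bool (g dvd b)))
      \<le> (\<Sum>g\<in>?I. real g * (of_bool (g dvd a) * of_bool (g dvd b)))"
      by (intro sum_mono2) auto
    then show "real (gcd a b) \<le> (\<Sum>g\<in>?I. real g * (of_bool (g dvd a) * of_bool (g dvd b)))" by simp
  qed
  also have "\<dots> = (\<Sum>a\<in>?I. \<Sum>g\<in>?I. \<Sum>b\<in>?I. real g * (of_bool (g dvd a) * of_bool (g dvd b)))"
    by (intro sum.cong refl sum.swap)
  also have "\<dots> = (\<Sum>g\<in>?I. \<Sum>a\<in>?I. \<Sum>b\<in>?I. real g * (of_bool (g dvd a) * of_bool (g dvd b)))"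
    by (rule sum.swap)
  also have "\<dots> = (\<Sum>g\<in>?I. g * (\<Sum>a\<in>?I. of_bool (g dvd a)) ^ 2)"
    by (simp add: power2_eq_square sum_product flip: sum_distrib_left)
  also have "\<dots> = (\<Sum>g\<in>?I. g * real (card {a\<in>?I. g dvd a}) ^ 2)"
    by (simp add: of_bool_def sum.If_cases Int_def)
  also have "\<dots> \<le> (\<Sum>g\<in>?I. g * (n / g) ^ 2)"
    using card_multiples_le by (intro sum_mono mult_left_mono power_mono) auto
  also have "\<dots> = (\<Sum>g\<in>?I. real n ^ 2 * inverse (real g))"
    by (intro sum.cong refl) (auto simp: field_simps power2_eq_square)
  also have "\<dots> = real n ^ 2 * harm n"
    by (simp add: harm_def sum_distrib_left)
  \<comment> \<open>The sequence \<open>harm n - ln n\<close> decreases from its value 1 at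
    \<open>n = 1\<close>.\<close>
  also have "\<dots> \<le> real n ^ 2 * (1 + ln n)"
    using euler_mascheroni_sequence_decreasing[of 1 n] False
    by (intro mult_left_mono) (auto simp: harm_expand)
  finally show ?thesis .
qed simp
lemma dyadic_subset_atLeastAtMost:
  fixes P :: real
  assumes "P \<ge> 1" "\<forall>a\<in>S. P \<le> real a \<and> real a \<le> 2 * P"
  shows "S \<subseteq> {1..nat \<lfloor>2 * P\<rfloor>}" "finite S"
proof -
  show "S \<subseteq> {1..nat \<lfloor>2 * P\<rfloor>}"
  proof
    fix a assume "a \<in> S"
    then have "1 \<le> real a" "real a \<le> 2 * P" using assms by force+
    then show "a \<in> {1..nat \<lfloor>2 * P\<rfloor>}" by (simp add: le_nat_floor)
  qed
  then show "finite S" by (rule finite_subset) simp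
qed

lemma sum_gcd_dyadic_le:
  fixes P :: real
  assumes "P \<ge> 1" "\<forall>a\<in>S. P \<le> real a \<and> real a \<le> 2 * P"
  shows "(\<Sum>a\<in>S. \<Sum>b\<in>S. real (gcd a b)) \<le> 4 * P ^ 2 * (1 + ln (2 * P))"
proof -
  let ?N = "nat \<lfloor>2 * P\<rfloor>"
  note sub = dyadic_subset_atLeastAtMost[OF assms]
  have N: "1 \<le> real ?N" "real ?N \<le> 2 * P" using assms(1) by linarith+
  have "(\<Sum>a\<in>S. \<Sum>b\<in>S. real (gcd a b)) \<le> (\<Sum>a\<in>{1..?N}. \<Sum>b\<in>{1..?N}. real (gcd a b))"
    using sub by (intro sum_mono2 order_trans[OF sum_mono sum_mono2] sum_nonneg) auto
  also have "\<dots> \<le> real ?N ^ 2 * (1 + ln ?N)" by (rule sum_gcd_le)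
  also have "\<dots> \<le> (2 * P) ^ 2 * (1 + ln (2 * P))"
    using N by (intro mult_mono power_mono add_left_mono) auto
  finally show ?thesis by (simp add: power_mult_distrib)
qed

section \<open>Variance bound for integers that miss every window\<close>

text \<open>Chebyshev's method: at a point of \<open>Z\<close> every indicator vanishes, so the
  total deviation \<open>D\<close> is as negative as possible, while the correlation bound and the
  gcd sum control the weighted second moment \<open>V\<close>.\<close>

lemma card_missed_le:
  fixes P :: real and S :: "nat set" and l n :: nat
  assumes P: "P \<ge> 1" and S: "\<forall>a\<in>S. P \<le> real a \<and> real a \<le> 2 * P"
    and l: "0 < l" "real l \<le> P" and n: "n > 0"
  defines "Z \<equiv> {z :: nat. 2 * z \<le> n \<and> (\<forall>a\<in>S. l \<le> z mod a)}"
  shows "real (card Z) * real (card S) ^ 2 \<le> 32 * (1 + ln (2 * P)) * P ^ 2 * (n / l + 40 * P ^ 4 / n)"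
proof -
  define h where "h = 1 + ln (2 * P)"
  \<comment> \<open>With this shift \<open>c + u + v\<close> runs from \<open>1 - n\<close> to
    \<open>n - 1\<close> with triangular weights peaking at 0. A point \<open>z\<close> with
    \<open>2 * z \<le> n\<close> is hit \<open>n - z\<close> times, which is at least
    \<open>n / 2\<close>.\<close>
  define c where "c = 1 - int n"
  define D where "D z = (\<Sum>a\<in>S. window_deviation l a z)" for z
  define V where "V = (\<Sum>u<n. \<Sum>v<n. D (c + int u + int v) ^ 2)"
  have pos: "a > 0" "l \<le> a" if "a \<in> S" for a using that P S l by force+
  have "V = (\<Sum>u<n. \<Sum>v<n. \<Sum>a\<in>S. \<Sum>b\<in>S. window_deviation l a (c + int u + int v) * window_deviation l b (c + int u + int v))"
    by (simp add: V_def D_def power2_eq_square sum_product)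
  also have "\<dots> = (\<Sum>a\<in>S. \<Sum>b\<in>S. \<Sum>u<n. \<Sum>v<n. window_deviation l a (c + int u + int v) * window_deviation l b (c + int u + int v))"
    by (simp add: sum.swap[of _ S "{..<n}"])
  also have "\<dots> \<le> (\<Sum>a\<in>S. \<Sum>b\<in>S. (real n ^ 2 * l / P ^ 2 + 40 * P ^ 2 * real l ^ 2) * gcd a b)"
  proof (intro sum_mono)
    fix a b assume ab: "a \<in> S" "b \<in> S"
    define g where "g = real (gcd a b)"
    have g: "1 \<le> g" using pos(1)[OF ab(1)] by (simp add: g_def Suc_le_eq)
    have "P ^ 2 \<le> real a * real b"
      using ab S P unfolding power2_eq_square by (intro mult_mono) auto
    then have "real n ^ 2 * (l * g / (a * b)) \<le> real n ^ 2 * (l * g / P ^ 2)"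
      using P g pos ab by (intro mult_left_mono divide_left_mono) auto
    \<comment> \<open>Here \<open>1 \<le> g\<close> and \<open>1 \<le> l\<close> merge both summands
      into \<open>5 * l ^ 2 * g\<close>; the constant 40 is \<open>2 * 4 * 5\<close>.\<close>
    moreover have "2 * (real a * real b) * (4 * real l ^ 2 + l * g) \<le> 2 * ((2 * P) * (2 * P)) * (5 * (real l ^ 2 * g))"
    proof (intro mult_mono)
      have "real l ^ 2 * 1 \<le> real l ^ 2 * g" using g by (intro mult_left_mono) auto
      moreover have "real l * 1 * g \<le> real l * real l * g" using g l by (intro mult_right_mono mult_left_mono) auto
      ultimately show "4 * real l ^ 2 + l * g \<le> 5 * (real l ^ 2 * g)" by (simp add: power2_eq_square)
    qed (use ab S P g in auto)
    ultimately have "real n ^ 2 * (l * g / (a * b)) + 2 * (real a * real b) * (4 * real l ^ 2 + l * g)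
      \<le> (real n ^ 2 * l / P ^ 2 + 40 * P ^ 2 * real l ^ 2) * g"
      by (simp add: algebra_simps power2_eq_square)
    then show "(\<Sum>u<n. \<Sum>v<n. window_deviation l a (c + int u + int v) * window_deviation l b (c + int u + int v))
      \<le> (real n ^ 2 * l / P ^ 2 + 40 * P ^ 2 * real l ^ 2) * gcd a b"
      using correlation_le[where a = a and b = b and l = l and n = n and c = c] pos ab
      by (simp add: g_def)
  qed
  also have "\<dots> = (real n ^ 2 * l / P ^ 2 + 40 * P ^ 2 * real l ^ 2) * (\<Sum>a\<in>S. \<Sum>b\<in>S. real (gcd a b))"
    by (simp only: sum_distrib_left)
  also have "\<dots> \<le> (real n ^ 2 * l / P ^ 2 + 40 * P ^ 2 * real l ^ 2) * (4 * P ^ 2 * h)"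
    unfolding h_def by (intro mult_left_mono sum_gcd_dyadic_le[OF P S]) auto
  finally have upper: "V \<le> (real n ^ 2 * l / P ^ 2 + 40 * P ^ 2 * real l ^ 2) * (4 * P ^ 2 * h)" .

  have "finite Z" by (rule finite_subset[of _ "{..n}"]) (auto simp: Z_def)
  define K where "K = (card S * l / (2 * P)) ^ 2"
  have K: "K \<le> D (int z) ^ 2" if "z \<in> Z" for z
  proof -
    have "card S * l / (2 * P) = (\<Sum>a\<in>S. l / (2 * P))" by simp
    also have "\<dots> \<le> (\<Sum>a\<in>S. real l / real a)"
      using S P pos by (intro sum_mono divide_left_mono) auto
    also have "\<dots> = - D (int z)"
      using that unfolding D_def Z_def sum_negf[symmetric]
      by (intro sum.cong refl) (auto simp: window_deviation_of_nat)
    finally have "(card S * l / (2 * P)) ^ 2 \<le> (- D (int z)) ^ 2"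
      using P by (intro power_mono) auto
    then show ?thesis by (simp add: K_def)
  qed
  \<comment> \<open>A pair \<open>(z, u)\<close> in \<open>T\<close> encodes the representation
    \<open>z = c + u + v\<close> with \<open>v = n - 1 + z - u\<close>; the bounds
    \<open>z \<le> u < n\<close> keep \<open>v\<close> in range.\<close>
  define T where "T = Sigma Z (\<lambda>z. {z..<n})"
  define \<phi> where "\<phi> = (\<lambda>(z, u). (u, n - 1 + z - u))"
  define E where "E = (\<lambda>(u, v). D (c + int u + int v) ^ 2)"
  have inj: "inj_on \<phi> T" by (rule inj_onI) (auto simp: \<phi>_def T_def)
  have "real (card Z) * (n / 2) * K = (\<Sum>z\<in>Z. n / 2) * K" by simp
  also have "\<dots> \<le> (\<Sum>z\<in>Z. real (card {z..<n})) * K"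
    by (intro mult_right_mono sum_mono) (auto simp: Z_def K_def)
  also have "\<dots> = (\<Sum>t\<in>T. K)"
    using \<open>finite Z\<close> by (simp add: T_def)
  also have "\<dots> \<le> (\<Sum>t\<in>T. E (\<phi> t))"
  proof (rule sum_mono)
    fix t assume "t \<in> T"
    then obtain z u where t: "t = (z, u)" "z \<in> Z" "z \<le> u" "u < n" by (auto simp: T_def)
    then have "c + int u + int (n - 1 + z - u) = int z" by (simp add: c_def)
    then have "E (\<phi> t) = D (int z) ^ 2" by (simp only: t(1) E_def \<phi>_def prod.case)
    then show "K \<le> E (\<phi> t)" using K t by simp
  qed
  also have "\<dots> = sum E (\<phi> ` T)" by (simp add: sum.reindex[OF inj])
  also have "\<dots> \<le> sum E ({..<n} \<times> {..<n})"
    by (rule sum_mono2) (auto simp: E_def \<phi>_def T_def)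
  also have "\<dots> = V" by (simp add: V_def E_def sum.cartesian_product)
  finally have "real (card Z) * (n / 2) * K \<le> (real n ^ 2 * l / P ^ 2 + 40 * P ^ 2 * real l ^ 2) * (4 * P ^ 2 * h)"
    using upper by simp
  \<comment> \<open>The multiplier is chosen to turn \<open>n / 2 * K\<close> into
    \<open>card S ^ 2\<close>.\<close>
  then have "real (card Z) * (n / 2) * K * (8 * P ^ 2 / (n * real l ^ 2))
    \<le> (real n ^ 2 * l / P ^ 2 + 40 * P ^ 2 * real l ^ 2) * (4 * P ^ 2 * h) * (8 * P ^ 2 / (n * real l ^ 2))"
    by (rule mult_right_mono) simp
  moreover have "real (card Z) * (n / 2) * K * (8 * P ^ 2 / (n * real l ^ 2)) = real (card Z) * real (card S) ^ 2"
    using P l n by (simp add: K_def field_simps)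
  moreover have "(real n ^ 2 * l / P ^ 2 + 40 * P ^ 2 * real l ^ 2) * (4 * P ^ 2 * h) * (8 * P ^ 2 / (n * real l ^ 2))
    = 32 * h * P ^ 2 * (n / l + 40 * P ^ 4 / n)"
    using P l n by (simp add: field_simps power2_eq_square power4_eq_xxxx)
  ultimately show ?thesis by (simp add: h_def)
qed

section \<open>Multiplicative energy and the number of distinct products\<close>

text \<open>Cancelling the gcd in \<open>a * b = a' * b'\<close> shows that
  \<open>h = a' / gcd a a'\<close> divides \<open>b\<close>, and \<open>b\<close> determines
  \<open>b'\<close>. There are at most \<open>2 * P / h\<close> multiples of \<open>h\<close>
  available, and \<open>P \<le> a'\<close> turns this into the gcd.\<close>

lemma card_equal_products_le:
  fixes P :: real
  assumes P: "P \<ge> 1" and T: "\<forall>a\<in>T. P \<le> real a \<and> real a \<le> 2 * P"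
    and a: "a > 0" "P \<le> real a'"
  shows "(\<Sum>b\<in>T. \<Sum>b'\<in>T. of_bool (a * b = a' * b')) \<le> 2 * real (gcd a a')"
proof -
  let ?N = "nat \<lfloor>2 * P\<rfloor>"
  note sub = dyadic_subset_atLeastAtMost[OF P T]
  define g where "g = gcd a a'"
  have "g > 0" "a' > 0" using a P by (auto simp: g_def)
  obtain k h where k: "a = k * g" and h: "a' = h * g" and cop: "coprime k h"
    using gcd_coprime_exists[of a a'] \<open>g > 0\<close> unfolding g_def by auto
  have "h > 0" using h \<open>a' > 0\<close> by (cases h) auto
  have "(\<Sum>b\<in>T. \<Sum>b'\<in>T. of_bool (a * b = a' * b')) \<le> (\<Sum>b\<in>T. of_bool (h dvd b) :: real)"
  proof (rule sum_mono)
    fix b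
    have dvd: "h dvd b" if "a * b = a' * b'" for b'
    proof -
      have "k * b = h * b'" using that \<open>g > 0\<close> by (auto simp: k h)
      then show ?thesis using cop by (metis coprime_commute coprime_dvd_mult_right_iff dvd_triv_left)
    qed
    show "(\<Sum>b'\<in>T. of_bool (a * b = a' * b')) \<le> (of_bool (h dvd b) :: real)"
    proof (cases "h dvd b")
      case True
      have "{b'\<in>T. a * b = a' * b'} \<subseteq> {a * b div a'}" using \<open>a' > 0\<close> by auto
      then have "card {b'\<in>T. a * b = a' * b'} \<le> card {a * b div a'}" by (rule card_mono[rotated]) simp
      then show ?thesis using True sub by (simp add: of_bool_def sum.If_cases Int_def)
    next
      case False
      then have "a * b \<noteq> a' * b'" for b' using dvd by blast
      then show ?thesis by simp
    qed
  qed
  also have "\<dots> \<le> (\<Sum>b\<in>{1..?N}. of_bool (h dvd b))" using sub by (intro sum_mono2) auto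
  also have "\<dots> = card {b\<in>{1..?N}. h dvd b}" by (simp add: of_bool_def sum.If_cases Int_def)
  also have "\<dots> \<le> ?N / h" using \<open>h > 0\<close> by (rule card_multiples_le)
  also have "\<dots> \<le> 2 * P / h" using P by (intro divide_right_mono) auto
  also have "\<dots> \<le> 2 * real a' / h" using a by (intro divide_right_mono) auto
  also have "\<dots> = 2 * real g" using \<open>h > 0\<close> by (simp add: h)
  finally show ?thesis by (simp add: g_def)
qed

text \<open>Cauchy-Schwarz for the number \<open>r y\<close> of representations of \<open>y\<close>
  as a product. The sum of \<open>r y ^ 2\<close> is the multiplicative energy, which for fixed
  \<open>a\<close> and \<open>a'\<close> is bounded by their gcd.\<close>

lemma card_products_ge:
  fixes P :: real
  assumes P: "P \<ge> 1" and S: "\<forall>a\<in>S. P \<le> real a \<and> real a \<le> 2 * P"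
    and T: "\<forall>a\<in>T. P \<le> real a \<and> real a \<le> 2 * P"
  shows "real (card S) ^ 2 * real (card T) ^ 2
    \<le> real (card ((\<lambda>(a, b). a * b) ` (S \<times> T))) * (8 * P ^ 2 * (1 + ln (2 * P)))"
proof -
  define f where "f = (\<lambda>(a, b). a * b :: nat)"
  define B where "B = f ` (S \<times> T)"
  define r where "r y = (\<Sum>p\<in>S\<times>T. of_bool (f p = y) :: real)" for y
  note finS = dyadic_subset_atLeastAtMost(2)[OF P S] and finT = dyadic_subset_atLeastAtMost(2)[OF P T]
  have finB: "finite B" using finS finT by (simp add: B_def)
  have delta: "(\<Sum>y\<in>B. of_bool (f p = y) * of_bool (f q = y)) = (of_bool (f p = f q) :: real)"
    if "p \<in> S \<times> T" for p q
  proof -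
    have "(\<Sum>y\<in>B. of_bool (f p = y) * of_bool (f q = y)) = (\<Sum>y\<in>B. if y = f p then of_bool (f p = f q) else 0 :: real)"
      by (intro sum.cong refl) auto
    then show ?thesis using that finB by (simp add: B_def)
  qed
  have "real (card S) * real (card T) = (\<Sum>p\<in>S\<times>T. 1)" by (simp add: card_cartesian_product)
  also have "\<dots> = (\<Sum>p\<in>S\<times>T. \<Sum>y\<in>B. of_bool (f p = y) * of_bool (f p = y))"
    by (intro sum.cong refl) (subst delta, auto)
  also have "\<dots> = (\<Sum>y\<in>B. r y)"
    unfolding r_def by (subst sum.swap) (simp flip: of_bool_conj)
  finally have "(real (card S) * real (card T)) ^ 2 = (\<Sum>y\<in>B. r y) ^ 2" by simp
  also have "\<dots> \<le> (\<Sum>y\<in>B. r y ^ 2) * card B" by (rule sum_squared_le_sum_of_squares)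
  finally have cauchy: "(real (card S) * real (card T)) ^ 2 \<le> (\<Sum>y\<in>B. r y ^ 2) * card B" .
  have "(\<Sum>y\<in>B. r y ^ 2) = (\<Sum>y\<in>B. \<Sum>p\<in>S\<times>T. \<Sum>q\<in>S\<times>T. of_bool (f p = y) * of_bool (f q = y))"
    by (simp only: r_def power2_eq_square sum_product)
  also have "\<dots> = (\<Sum>p\<in>S\<times>T. \<Sum>q\<in>S\<times>T. \<Sum>y\<in>B. of_bool (f p = y) * of_bool (f q = y))"
    by (simp only: sum.swap[of _ "S \<times> T" B])
  also have "\<dots> = (\<Sum>p\<in>S\<times>T. \<Sum>q\<in>S\<times>T. of_bool (f p = f q))"
    by (intro sum.cong refl delta)
  also have "\<dots> = (\<Sum>a\<in>S. \<Sum>b\<in>T. \<Sum>a'\<in>S. \<Sum>b'\<in>T. of_bool (a * b = a' * b'))"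
    by (simp only: f_def sum.cartesian_product' prod.case)
  also have "\<dots> = (\<Sum>a\<in>S. \<Sum>a'\<in>S. \<Sum>b\<in>T. \<Sum>b'\<in>T. of_bool (a * b = a' * b'))"
    by (intro sum.cong refl sum.swap)
  also have "\<dots> \<le> (\<Sum>a\<in>S. \<Sum>a'\<in>S. 2 * real (gcd a a'))"
    using S P by (intro sum_mono card_equal_products_le[OF P T]) force+
  also have "\<dots> = 2 * (\<Sum>a\<in>S. \<Sum>a'\<in>S. real (gcd a a'))" by (simp only: sum_distrib_left)
  also have "\<dots> \<le> 2 * (4 * P ^ 2 * (1 + ln (2 * P)))"
    by (intro mult_left_mono sum_gcd_dyadic_le[OF P S]) auto
  finally have "(\<Sum>y\<in>B. r y ^ 2) \<le> 8 * P ^ 2 * (1 + ln (2 * P))" by simp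
  then have "(\<Sum>y\<in>B. r y ^ 2) * card B \<le> 8 * P ^ 2 * (1 + ln (2 * P)) * card B"
    by (rule mult_right_mono) simp
  with cauchy have "(real (card S) * real (card T)) ^ 2 \<le> card B * (8 * P ^ 2 * (1 + ln (2 * P)))"
    by (simp only: mult.commute[of "real (card B)"])
  then show ?thesis by (simp only: B_def f_def power_mult_distrib)
qed

section \<open>From missed windows to products in the interval\<close>

text \<open>The two quotients differ by \<open>X * (b' - b) / (b * b')\<close>, which is at least
  1.\<close>

lemma floor_divide_less:
  fixes X :: real and b b' :: nat
  assumes "0 < b" "b < b'" "real b * real b' \<le> X"
  shows "\<lfloor>X / b'\<rfloor> < \<lfloor>X / b\<rfloor>"
proof -
  have "1 \<le> X / (real b * real b')" using assms by simp
  also have "\<dots> \<le> X / (real b * real b') * (real b' - real b)"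
    using assms mult_left_mono[of 1 "real b' - real b" "X / (real b * real b')"]
    by (simp add: order_trans[OF _ assms(3)])
  also have "\<dots> = X / b - X / b'" using assms by (simp add: field_simps)
  finally show ?thesis by linarith
qed

text \<open>If no product lies in the interval, \<open>\<zeta>\<close> embeds the products
  \<open>B\<close> of \<open>S2\<close> and \<open>S3\<close> into the set \<open>Z\<close> of
  integers missing all windows of length \<open>k ^ 2\<close>. The lower bound for
  \<open>card B\<close> and the upper bound for \<open>card Z\<close> then contradict
  \<open>large\<close>.\<close>

lemma product_in_interval:
  fixes P x H :: real and k :: nat and S1 S2 S3 :: "nat set"
  assumes P: "P \<ge> 1"
    and S1: "\<forall>a\<in>S1. P \<le> real a \<and> real a \<le> 2 * P"
    and S2: "\<forall>a\<in>S2. P \<le> real a \<and> real a \<le> 2 * P"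
    and S3: "\<forall>a\<in>S3. P \<le> real a \<and> real a \<le> 2 * P"
    and x: "x = 81 * P ^ 4" and H: "0 \<le> H" "H \<le> x" "4 * P ^ 2 * real k ^ 2 \<le> H"
    and k: "k \<ge> 324" "real k ^ 2 \<le> P"
    and large: "10752 * (1 + ln (2 * P)) ^ 2 * P ^ 6 / k
      < real (card S1) ^ 2 * real (card S2) ^ 2 * real (card S3) ^ 2"
  shows "\<exists>m. \<exists>a1\<in>S1. \<exists>a2\<in>S2. \<exists>a3\<in>S3. x \<le> real (m * a1 * a2 * a3) \<and> real (m * a1 * a2 * a3) \<le> x + H"
proof (rule ccontr)
  assume neg: "\<not> ?thesis"
  define h where "h = 1 + ln (2 * P)"
  have h: "h \<ge> 0" using P by (simp add: h_def)
  \<comment> \<open>This size balances the two error terms \<open>n / k ^ 2\<close> and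
    \<open>P ^ 4 / n\<close>: both become of order \<open>P ^ 2 / k\<close>.\<close>
  define n where "n = nat \<lceil>P ^ 2 * k\<rceil>"
  have P2: "1 \<le> P ^ 2" using P by simp
  have "1 * 1 \<le> P ^ 2 * real k" using P2 k by (intro mult_mono) auto
  then have n: "P ^ 2 * k \<le> n" "n \<le> 2 * (P ^ 2 * k)" unfolding n_def by linarith+
  have "0 < P ^ 2 * real k" using P k by simp
  then have "n > 0" using n by linarith
  define Z where "Z = {z :: nat. 2 * z \<le> n \<and> (\<forall>a\<in>S1. k ^ 2 \<le> z mod a)}"
  define B where "B = (\<lambda>(a, b). a * b) ` (S2 \<times> S3)"
  define \<zeta> where "\<zeta> b = nat \<lfloor>(x + H) / real b\<rfloor>" for b :: nat
  have B: "P ^ 2 \<le> real b" "real b \<le> 4 * P ^ 2" if bB: "b \<in> B" for b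
  proof -
    obtain a2 a3 where b: "b = a2 * a3" "a2 \<in> S2" "a3 \<in> S3" using bB by (auto simp: B_def)
    have "P * P \<le> real a2 * real a3" using b S2 S3 P by (intro mult_mono) auto
    then show "P ^ 2 \<le> real b" by (simp add: b power2_eq_square)
    have "real a2 * real a3 \<le> (2 * P) * (2 * P)" using b S2 S3 P by (intro mult_mono) auto
    then show "real b \<le> 4 * P ^ 2" by (simp add: b power2_eq_square)
  qed
  have "x \<ge> 0" by (simp add: x)
  have "inj_on \<zeta> B"
  proof (rule linorder_inj_onI')
    fix b b' assume b: "b \<in> B" "b' \<in> B" "b < b'"
    have pos: "0 < b" using B(1)[OF b(1)] P2 by linarith
    \<comment> \<open>The bound \<open>16 * P ^ 4\<close> stays below \<open>x = 81 * P ^ 4\<close>,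
      so distinct \<open>b\<close> have distinct floors.\<close>
    have "real b * real b' \<le> (4 * P ^ 2) * (4 * P ^ 2)" using B b by (intro mult_mono) auto
    also have "\<dots> \<le> x + H" using H by (simp add: x flip: power_add)
    finally have "\<lfloor>(x + H) / b'\<rfloor> < \<lfloor>(x + H) / b\<rfloor>" using b pos by (intro floor_divide_less)
    moreover have "0 \<le> \<lfloor>(x + H) / b'\<rfloor>" using H \<open>x \<ge> 0\<close> by simp
    ultimately show "\<zeta> b \<noteq> \<zeta> b'" unfolding \<zeta>_def by linarith
  qed
  moreover have "\<zeta> ` B \<subseteq> Z"
  proof
    fix z assume "z \<in> \<zeta> ` B"
    then obtain b where b: "b \<in> B" "z = \<zeta> b" by auto
    have pos: "0 < real b" using B(1)[OF b(1)] P2 by linarith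
    have "0 \<le> (x + H) / b" using H \<open>x \<ge> 0\<close> by simp
    then have z: "real z \<le> (x + H) / b" "(x + H) / b < real z + 1"
      unfolding b(2) \<zeta>_def by linarith+
    note z(1)
    \<comment> \<open>From \<open>H \<le> x\<close> follows \<open>z \<le> 162 * P ^ 2\<close>;
      doubling this explains the threshold 324 for \<open>k\<close>.\<close>
    also have "(x + H) / b \<le> (162 * P ^ 4) / P ^ 2"
      using H P B(1)[OF b(1)] by (intro frac_le) (auto simp: x)
    also have "\<dots> = 162 * P ^ 2" using P by (simp add: field_simps flip: power_add)
    finally have "2 * real z \<le> P ^ 2 * 324" by simp
    also have "\<dots> \<le> P ^ 2 * k" using k by (intro mult_left_mono) auto
    also note n(1)
    finally have "2 * z \<le> n" by linarith
    moreover have "k ^ 2 \<le> z mod a1" if a1: "a1 \<in> S1" for a1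
    proof (rule ccontr)
      assume less: "\<not> k ^ 2 \<le> z mod a1"
      define m where "m = z div a1"
      obtain a2 a3 where a: "b = a2 * a3" "a2 \<in> S2" "a3 \<in> S3" using b by (auto simp: B_def)
      \<comment> \<open>The extra 1, gained from strictness over the integers, absorbs the fraction
        lost in the floor: only \<open>x + H < (z + 1) * b\<close> is known.\<close>
      have m: "m * a1 \<le> z" "z + 1 \<le> m * a1 + k ^ 2"
        using less div_mult_mod_eq[of z a1] unfolding m_def by linarith+
      have "real (m * a1) * b \<le> real z * b"
        using m(1) by (intro mult_right_mono) (auto simp only: of_nat_le_iff of_nat_0_le_iff)
      also have "\<dots> \<le> x + H" using z(1) pos by (simp add: pos_le_divide_eq)
      finally have "real (m * a1 * a2 * a3) \<le> x + H" by (simp add: a mult_ac)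
      moreover have "x \<le> real (m * a1 * a2 * a3)"
      proof -
        have "x + H \<le> (real z + 1) * b" using z(2) pos by (simp add: pos_divide_less_eq)
        also have "\<dots> \<le> (real (m * a1) + real k ^ 2) * b"
        proof (rule mult_right_mono)
          have "real (z + 1) \<le> real (m * a1 + k ^ 2)" using m(2) by (simp only: of_nat_le_iff)
          then show "real z + 1 \<le> real (m * a1) + real k ^ 2" by simp
        qed simp
        also have "\<dots> = real (m * a1 * a2 * a3) + real k ^ 2 * b" by (simp add: a algebra_simps)
        also have "real k ^ 2 * b \<le> real k ^ 2 * (4 * P ^ 2)" using B(2)[OF b(1)] by (intro mult_left_mono) auto
        also have "\<dots> \<le> H" using H by (simp add: mult_ac)
        finally show ?thesis by simp
      qed
      ultimately show False using neg a1 a by blast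
    qed
    ultimately show "z \<in> Z" by (simp add: Z_def)
  qed
  moreover have "finite Z" by (rule finite_subset[of _ "{..n}"]) (auto simp: Z_def)
  ultimately have "card B \<le> card Z" by (rule card_inj_on_le)
  have k0: "0 < k ^ 2" "real (k ^ 2) \<le> P" using k by auto
  have "n / real (k ^ 2) \<le> 2 * (P ^ 2 * k) / real (k ^ 2)" using n by (intro divide_right_mono) auto
  also have "\<dots> = 2 * P ^ 2 / k" using k by (simp add: power2_eq_square)
  finally have t1: "n / real (k ^ 2) \<le> 2 * P ^ 2 / k" .
  have "40 * P ^ 4 / n \<le> 40 * P ^ 4 / (P ^ 2 * k)"
    by (intro divide_left_mono mult_pos_pos n(1) \<open>0 < P ^ 2 * real k\<close>) (use \<open>n > 0\<close> in simp_all)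
  also have "\<dots> = 40 * P ^ 2 / k" using P by (simp add: power2_eq_square power4_eq_xxxx)
  finally have t2: "40 * P ^ 4 / n \<le> 40 * P ^ 2 / k" .
  have "real (card Z) * real (card S1) ^ 2 \<le> 32 * h * P ^ 2 * (n / real (k ^ 2) + 40 * P ^ 4 / n)"
    unfolding Z_def h_def by (rule card_missed_le[OF P S1 k0 \<open>n > 0\<close>])
  also have "\<dots> \<le> 32 * h * P ^ 2 * (2 * P ^ 2 / k + 40 * P ^ 2 / k)"
    using t1 t2 h by (intro mult_left_mono add_mono) auto
  also have "\<dots> = 1344 * h * P ^ 4 / k" by (simp add: field_simps flip: power_add)
  finally have cZ: "real (card Z) * real (card S1) ^ 2 \<le> 1344 * h * P ^ 4 / k" .
  have "real (card S1) ^ 2 * (real (card S2) ^ 2 * real (card S3) ^ 2)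
    \<le> real (card S1) ^ 2 * (real (card B) * (8 * P ^ 2 * h))"
    unfolding B_def h_def by (intro mult_left_mono card_products_ge[OF P S2 S3]) auto
  also have "\<dots> \<le> real (card S1) ^ 2 * (real (card Z) * (8 * P ^ 2 * h))"
    using \<open>card B \<le> card Z\<close> h by (intro mult_left_mono mult_right_mono) auto
  also have "\<dots> = (real (card Z) * real (card S1) ^ 2) * (8 * P ^ 2 * h)" by simp
  also have "\<dots> \<le> (1344 * h * P ^ 4 / k) * (8 * P ^ 2 * h)" using cZ h by (intro mult_right_mono) auto
  also have "\<dots> = 10752 * h ^ 2 * P ^ 6 / k" by (simp add: power2_eq_square eval_nat_numeral)
  finally show False using large by (simp add: h_def mult.assoc)
qed

section \<open>Choice of parameters and conclusion\<close>

lemma almost_dense_card_ge: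
  assumes "almost_dense A"
  obtains c :: real where "c > 0"
    "\<forall>\<^sub>F X in at_top. c * X powr (99 / 100) \<le> real (card {n\<in>A. X \<le> real n \<and> real n \<le> 2 * X})"
proof -
  have "\<forall>\<epsilon>>0. \<exists>c>0. \<forall>\<^sub>F X :: real in at_top.
      real (card {n \<in> A. X \<le> real n \<and> real n \<le> 2 * X}) \<ge> c * X powr (1 - \<epsilon> / 4)"
    using assms by (simp add: almost_dense_def)
  from this[rule_format, of "1 / 25"] show thesis using that by auto
qed

theorem theorem2:
  fixes \<epsilon> :: real and A1 A2 A3 :: "nat set"
  assumes "\<epsilon> > 0"
    and "almost_dense A1" and "almost_dense A2" and "almost_dense A3"
  shows "\<exists>c C :: real. 0 < c \<and> c < C \<and>
    (\<forall>\<^sub>F x :: real in at_top.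
       \<exists>n m a1 a2 a3 :: nat.
         n = m * a1 * a2 * a3 \<and>
         x \<le> real n \<and> real n \<le> x + x powr (34 / 55 + \<epsilon>) \<and>
         a1 \<in> A1 \<and> a2 \<in> A2 \<and> a3 \<in> A3 \<and> 0 < m \<and>
         (\<forall>k\<in>{a1, a2, a3, m}. c * x powr (1 / 4) \<le> real k \<and> real k \<le> C * x powr (1 / 4)))"
proof -
  \<comment> \<open>The divisor 3 gives \<open>x = 81 * P x ^ 4\<close>, the normalisation required
    by \<open>product_in_interval\<close>.\<close>
  define P :: "real \<Rightarrow> real" where "P x = x powr (1 / 4) / 3" for x
  define S where "S A x = {n\<in>A. P x \<le> real n \<and> real n \<le> 2 * P x}" for A x
  obtain c1 where c1: "c1 > 0"
    "\<forall>\<^sub>F X in at_top. c1 * X powr (99 / 100) \<le> real (card {n\<in>A1. X \<le> real n \<and> real n \<le> 2 * X})"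
    using almost_dense_card_ge[OF assms(2)] .
  obtain c2 where c2: "c2 > 0"
    "\<forall>\<^sub>F X in at_top. c2 * X powr (99 / 100) \<le> real (card {n\<in>A2. X \<le> real n \<and> real n \<le> 2 * X})"
    using almost_dense_card_ge[OF assms(3)] .
  obtain c3 where c3: "c3 > 0"
    "\<forall>\<^sub>F X in at_top. c3 * X powr (99 / 100) \<le> real (card {n\<in>A3. X \<le> real n \<and> real n \<le> 2 * X})"
    using almost_dense_card_ge[OF assms(4)] .
  have lim: "filterlim P at_top at_top" unfolding P_def by real_asymp
  have dens: "\<forall>\<^sub>F x in at_top. c1 * P x powr (99 / 100) \<le> real (card (S A1 x))"
    "\<forall>\<^sub>F x in at_top. c2 * P x powr (99 / 100) \<le> real (card (S A2 x))"
    "\<forall>\<^sub>F x in at_top. c3 * P x powr (99 / 100) \<le> real (card (S A3 x))"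
    using c1(2) c2(2) c3(2) lim unfolding S_def
    by (auto intro: eventually_compose_filterlim)
  \<comment> \<open>Three squared cardinalities supply the exponent
    \<open>6 * 99 / 100 = 297 / 50\<close>. The loss of \<open>P x powr (3 / 50)\<close> and the
    logarithms are outweighed by \<open>x powr (1 / 20)\<close>, of order
    \<open>P x powr (1 / 5)\<close>.\<close>
  have "((\<lambda>x. 10752 * (1 + ln (2 * P x)) ^ 2 * P x ^ 6 / (x powr (1 / 20) - 1) / P x powr (297 / 50)) \<longlongrightarrow> 0) at_top"
    unfolding P_def by real_asymp
  moreover have "0 < (c1 * c2 * c3) ^ 2" using c1 c2 c3 by simp
  ultimately have ratio: "\<forall>\<^sub>F x in at_top. 10752 * (1 + ln (2 * P x)) ^ 2 * P x ^ 6 / (x powr (1 / 20) - 1) / P x powr (297 / 50)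
      < (c1 * c2 * c3) ^ 2"
    by (rule order_tendstoD)
  \<comment> \<open>The value 325 leaves room for the floor in \<open>k \<ge> 324\<close>. The
    fourth condition holds because its left side has order \<open>x powr (3 / 5)\<close>, and
    \<open>3 / 5 < 34 / 55\<close>.\<close>
  have ev: "\<forall>\<^sub>F x in at_top. P x \<ge> 1"
    "\<forall>\<^sub>F x in at_top. (x::real) powr (1 / 20) \<ge> 325"
    "\<forall>\<^sub>F x in at_top. x powr (1 / 10) \<le> P x"
    "\<forall>\<^sub>F x in at_top. 4 * P x ^ 2 * x powr (1 / 10) \<le> x powr (34 / 55)"
    "\<forall>\<^sub>F x in at_top. (x::real) powr (34 / 55) \<le> x"
    unfolding P_def by real_asymp+
  have "\<forall>\<^sub>F x :: real in at_top.
       \<exists>n m a1 a2 a3 :: nat.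
         n = m * a1 * a2 * a3 \<and>
         x \<le> real n \<and> real n \<le> x + x powr (34 / 55 + \<epsilon>) \<and>
         a1 \<in> A1 \<and> a2 \<in> A2 \<and> a3 \<in> A3 \<and> 0 < m \<and>
         (\<forall>k\<in>{a1, a2, a3, m}. 1 / 3 * x powr (1 / 4) \<le> real k \<and> real k \<le> 54 * x powr (1 / 4))"
    using dens ratio ev eventually_ge_at_top[of 1]
  proof eventually_elim
    case (elim x)
    define k where "k = nat \<lfloor>x powr (1 / 20)\<rfloor>"
    define p where "p = P x"
    have k: "real k \<le> x powr (1 / 20)" "x powr (1 / 20) - 1 < real k" "k \<ge> 324"
      using elim(6) unfolding k_def by linarith+
    have "real k ^ 2 \<le> (x powr (1 / 20)) ^ 2" using k by (intro power_mono) auto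
    also have "\<dots> = x powr (1 / 10)" using \<open>1 \<le> x\<close> by (simp add: powr_power)
    finally have k2: "real k ^ 2 \<le> x powr (1 / 10)" .
    have p: "1 \<le> p" using elim(5) by (simp add: p_def)
    have x: "x = 81 * p ^ 4" using \<open>1 \<le> x\<close> by (simp add: p_def P_def power_divide powr_power)
    have "4 * p ^ 2 * real k ^ 2 \<le> 4 * p ^ 2 * x powr (1 / 10)" using k2 by (intro mult_left_mono) auto
    then have H: "4 * p ^ 2 * real k ^ 2 \<le> x powr (34 / 55)" using elim(8) by (simp add: p_def)
    have "10752 * (1 + ln (2 * p)) ^ 2 * p ^ 6 / k \<le> 10752 * (1 + ln (2 * p)) ^ 2 * p ^ 6 / (x powr (1 / 20) - 1)"
      using k elim(6) p by (intro divide_left_mono) auto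
    also have "\<dots> < (c1 * c2 * c3) ^ 2 * p powr (297 / 50)"
      using elim(4) p unfolding p_def[symmetric] by (subst (asm) pos_divide_less_eq) auto
    also have "\<dots> = (c1 * p powr (99 / 100)) ^ 2 * (c2 * p powr (99 / 100)) ^ 2 * (c3 * p powr (99 / 100)) ^ 2"
      using p by (simp add: power_mult_distrib powr_power flip: powr_add)
    also have "\<dots> \<le> real (card (S A1 x)) ^ 2 * real (card (S A2 x)) ^ 2 * real (card (S A3 x)) ^ 2"
      using elim(1-3) c1 c2 c3 by (intro mult_mono power_mono) (auto simp: p_def)
    finally have large: "10752 * (1 + ln (2 * p)) ^ 2 * p ^ 6 / k
      < real (card (S A1 x)) ^ 2 * real (card (S A2 x)) ^ 2 * real (card (S A3 x)) ^ 2" .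
    have S: "\<forall>a\<in>S A x. p \<le> real a \<and> real a \<le> 2 * p" for A by (simp add: S_def p_def)
    have "real k ^ 2 \<le> p" using k2 elim(7) by (simp add: p_def)
    from product_in_interval[OF p S S S x _ elim(9) H k(3) this large]
    obtain m a1 a2 a3 where a: "a1 \<in> S A1 x" "a2 \<in> S A2 x" "a3 \<in> S A3 x"
      and m: "x \<le> real (m * a1 * a2 * a3)" "real (m * a1 * a2 * a3) \<le> x + x powr (34 / 55)"
      by auto
    have ap: "p \<le> real a1" "p \<le> real a2" "p \<le> real a3" "real a1 \<le> 2 * p" "real a2 \<le> 2 * p" "real a3 \<le> 2 * p"
      using a S by blast+
    have "0 < real (m * a1 * a2 * a3)" using m(1) \<open>1 \<le> x\<close> by linarith
    then have "0 < m" by (cases m) auto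
    \<comment> \<open>The size of \<open>m\<close> follows from that of the product, between
      \<open>81 * p ^ 4\<close> and \<open>162 * p ^ 4\<close>, and from
      \<open>p \<le> a \<le> 2 * p\<close> for the three factors. The bound \<open>162 * p\<close>
      is \<open>54 * x powr (1 / 4)\<close>.\<close>
    have "p * p ^ 3 * 81 \<le> real m * (real a1 * real a2 * real a3)" using m(1) by (simp add: x mult_ac power4_eq_xxxx power3_eq_cube)
    also have "\<dots> \<le> real m * ((2 * p) * (2 * p) * (2 * p))" using ap p by (intro mult_left_mono mult_mono) auto
    finally have "(81 * p) * p ^ 3 \<le> (8 * real m) * p ^ 3" by (simp add: power3_eq_cube mult_ac)
    then have m1: "81 * p \<le> 8 * real m" using p by (subst (asm) mult_le_cancel_right_pos) auto
    have "real m * (p * p * p) \<le> real m * (real a1 * real a2 * real a3)" using ap p by (intro mult_left_mono mult_mono) auto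
    also have "\<dots> \<le> 2 * x" using m(2) elim(9) by (simp add: mult_ac)
    finally have "real m * p ^ 3 \<le> (162 * p) * p ^ 3" by (simp add: x power3_eq_cube power4_eq_xxxx mult_ac)
    then have m2: "real m \<le> 162 * p" using p by (subst (asm) mult_le_cancel_right_pos) auto
    have x4: "x powr (1 / 4) = 3 * p" by (simp add: p_def P_def)
    have "x powr (34 / 55) \<le> x powr (34 / 55 + \<epsilon>)" using \<open>1 \<le> x\<close> assms(1) by (intro powr_mono) auto
    then have "real (m * a1 * a2 * a3) \<le> x + x powr (34 / 55 + \<epsilon>)" using m(2) by linarith
    moreover have "\<forall>k\<in>{a1, a2, a3, m}. 1 / 3 * x powr (1 / 4) \<le> real k \<and> real k \<le> 54 * x powr (1 / 4)"
      using ap m1 m2 p unfolding x4 by auto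
    moreover have "a1 \<in> A1" "a2 \<in> A2" "a3 \<in> A3" using a by (auto simp: S_def)
    ultimately show ?case using m(1) \<open>0 < m\<close> by blast
  qed
  moreover have "0 < (1 / 3 :: real)" "1 / 3 < (54 :: real)" by simp_all
  ultimately show ?thesis by blast
qed
end
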